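(* Let $(C_n,\mathbf{w})$ be a weighted cycle ($n\ge 3$) and $(P_m,\mathbf{w}')$ a weighted path. Then $c\big(C_n\square P_m,\mathbf{w}\square\mathbf{w}'\big)=c(C_n,\mathbf{w})+c(P_m,\mathbf{w}')$.
   Context: A weighted graph is a finite simple graph with positive integer edge weights that is weight-minimal: every edge is a shortest path between its endpoints. $d_\mathbf{w}$ is the weighted shortest-path distance. A binary addressing of length $m$ is a map $f:V\to\{0,1\}^m$ with $d_\mathbf{w}(u,v)\le d_H(f(u),f(v))$ for all $u,v$ ($d_H$ Hamming distance); $c(G,\mathbf{w})$ is the minimum such $m$. The weighted Cartesian product $(G_1\square G_2,\mathbf{w}_1\square\mathbf{w}_2)$ has vertex set $V(G_1)\times V(G_2)$; $(u,x)$ and $(v,x)$ are joined by an edge of weight $\mathbf{w}_1(uv)$ when $uv\in E(G_1)$, and $(u,x)$ and $(u,y)$ by an edge of weight $\mathbf{w}_2(xy)$ when $xy\in E(G_2)$. *)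

theory Defs
  imports Main "HOL-Library.Extended_Nat"
begin

text \<open>
  Edges are given by an adjacency relation and their weights by a function on ordered pairs;
  the values of the weight function on non-adjacent pairs carry no meaning.
\<close>

record 'a wgraph =
  verts :: "'a set"
  adj :: "'a \<Rightarrow> 'a \<Rightarrow> bool"
  weight :: "'a \<Rightarrow> 'a \<Rightarrow> nat"

text \<open>A path is the list of its vertices, which are pairwise distinct.\<close>

definition is_path :: "'a wgraph \<Rightarrow> 'a \<Rightarrow> 'a list \<Rightarrow> 'a \<Rightarrow> bool" where
  "is_path G u p v \<longleftrightarrow>
     p \<noteq> [] \<and> hd p = u \<and> last p = v \<and> set p \<subseteq> verts G \<and> distinct p \<and> successively (adj G) p"

fun path_weight :: "'a wgraph \<Rightarrow> 'a list \<Rightarrow> nat" where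
  "path_weight G (x # y # p) = weight G x y + path_weight G (y # p)"
| "path_weight G _ = 0"

text \<open>The distance is \<open>\<infinity>\<close> if there is no path.\<close>

definition wdist :: "'a wgraph \<Rightarrow> 'a \<Rightarrow> 'a \<Rightarrow> enat" where
  "wdist G u v = (INF p \<in> {p. is_path G u p v}. enat (path_weight G p))"

definition weighted_graph :: "'a wgraph \<Rightarrow> bool" where
  "weighted_graph G \<longleftrightarrow>
     finite (verts G) \<and>
     (\<forall>u v. adj G u v \<longrightarrow> u \<in> verts G \<and> v \<in> verts G \<and> u \<noteq> v \<and> adj G v u) \<and>
     (\<forall>u v. adj G u v \<longrightarrow> weight G u v > 0 \<and> weight G u v = weight G v u) \<and>
     (\<forall>u v. adj G u v \<longrightarrow> wdist G u v = enat (weight G u v))"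

definition hamming :: "bool list \<Rightarrow> bool list \<Rightarrow> nat" where
  "hamming xs ys = card {i. i < length xs \<and> xs ! i \<noteq> ys ! i}"

definition is_addressing :: "'a wgraph \<Rightarrow> nat \<Rightarrow> ('a \<Rightarrow> bool list) \<Rightarrow> bool" where
  "is_addressing G m f \<longleftrightarrow>
     (\<forall>u \<in> verts G. length (f u) = m) \<and>
     (\<forall>u \<in> verts G. \<forall>v \<in> verts G. wdist G u v \<le> enat (hamming (f u) (f v)))"

text \<open>Meaningful for finite connected graphs, which always have an addressing of some length.\<close>

definition addressing_number :: "'a wgraph \<Rightarrow> nat" where
  "addressing_number G = (LEAST m. \<exists>f. is_addressing G m f)"

definition cart_prod :: "'a wgraph \<Rightarrow> 'b wgraph \<Rightarrow> ('a \<times> 'b) wgraph"  (infixr \<open>\<box>\<close> 70) where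
  "G \<box> H =
     \<lparr>verts = verts G \<times> verts H,
      adj = (\<lambda>(u, x) (v, y).
        (adj G u v \<and> x = y \<and> x \<in> verts H) \<or> (u = v \<and> u \<in> verts G \<and> adj H x y)),
      weight = (\<lambda>(u, x) (v, y). if x = y then weight G u v else weight H x y)\<rparr>"

text \<open>Both the cycle and the path of order \<open>n\<close> have the vertices \<open>0, \<dots>, n - 1\<close>.\<close>

definition cycle_graph :: "nat \<Rightarrow> (nat \<Rightarrow> nat \<Rightarrow> nat) \<Rightarrow> nat wgraph" where
  "cycle_graph n w =
     \<lparr>verts = {..<n},
      adj = (\<lambda>i j. i < n \<and> j < n \<and> (j = (i + 1) mod n \<or> i = (j + 1) mod n)),
      weight = w\<rparr>"

definition path_graph :: "nat \<Rightarrow> (nat \<Rightarrow> nat \<Rightarrow> nat) \<Rightarrow> nat wgraph" where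
  "path_graph n w =
     \<lparr>verts = {..<n},
      adj = (\<lambda>i j. i < n \<and> j < n \<and> (j = i + 1 \<or> i = j + 1)),
      weight = w\<rparr>"

end

theory Submission
  imports Defs
begin

text \<open>
  Let \<open>W\<close> be the total weight of the cycle and \<open>L\<close> that of the path. Any three words of length
  \<open>N\<close> have Hamming perimeter at most \<open>2 * N\<close>. The cycle has vertices \<open>x\<close>, \<open>y\<close>, \<open>z\<close> whose
  connecting arcs are all at most \<open>W / 2\<close> (by weight-minimality, the end points of a suitable edge
  together with the vertex \<open>0\<close>), so that their perimeter is \<open>W\<close>. Placing \<open>y\<close> at one end of the
  path and \<open>x\<close>, \<open>z\<close> at the other gives a triangle of perimeter \<open>W + 2 * L\<close> in the product, hence
  \<open>N \<ge> \<lceil>W / 2\<rceil> + L\<close>. Conversely, cycle and path have addressings of lengths \<open>\<lceil>W / 2\<rceil>\<close> and \<open>L\<close>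
  as parts of an even cycle in a hypercube, and addressings of the factors can be concatenated.
\<close>

section \<open>Hamming distance\<close>

lemma hamming_eq_sum:
  "hamming xs ys = (\<Sum>i<length xs. of_bool (xs ! i \<noteq> ys ! i))"
proof -
  have "{i. i < length xs \<and> xs ! i \<noteq> ys ! i} = {..<length xs} \<inter> {i. xs ! i \<noteq> ys ! i}"
    by auto
  then show ?thesis
    by (simp add: hamming_def)
qed

lemma hamming_commute: "length xs = length ys \<Longrightarrow> hamming xs ys = hamming ys xs"
  unfolding hamming_def by metis

lemma sum_lessThan_add:
  fixes f :: "nat \<Rightarrow> nat"
  shows "sum f {..<a + b} = sum f {..<a} + (\<Sum>i<b. f (a + i))"
  by (induction b) simp_all

lemma hamming_append:
  assumes "length xs = length ys"
  shows "hamming (xs @ us) (ys @ vs) = hamming xs ys + hamming us vs"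
proof -
  have "hamming (xs @ us) (ys @ vs) =
      (\<Sum>i<length xs + length us. of_bool ((xs @ us) ! i \<noteq> (ys @ vs) ! i))"
    by (simp add: hamming_eq_sum)
  also have "\<dots> = (\<Sum>i<length xs. of_bool ((xs @ us) ! i \<noteq> (ys @ vs) ! i)) +
      (\<Sum>i<length us. of_bool ((xs @ us) ! (length xs + i) \<noteq> (ys @ vs) ! (length xs + i)))"
    by (rule sum_lessThan_add)
  finally show ?thesis
    using assms by (simp add: hamming_eq_sum nth_append)
qed

text \<open>Among three bits two agree, so each coordinate separates at most two of the three
  pairs.\<close>

lemma hamming_perimeter_le:
  assumes "length xs = N" "length ys = N"
  shows "hamming xs ys + hamming ys zs + hamming xs zs \<le> 2 * N"
proof -
  have "hamming xs ys + hamming ys zs + hamming xs zs =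
      (\<Sum>i<N. of_bool (xs ! i \<noteq> ys ! i) + of_bool (ys ! i \<noteq> zs ! i) + of_bool (xs ! i \<noteq> zs ! i))"
    using assms by (simp add: hamming_eq_sum sum.distrib)
  also have "\<dots> \<le> (\<Sum>i<N. 2)"
    by (intro sum_mono) auto
  finally show ?thesis
    by simp
qed

text \<open>The vertex at position \<open>t\<close> of an isometric cycle of length \<open>2 * M\<close> in the hypercube of
  dimension \<open>M\<close>: the ones enter and then leave from the left.\<close>

definition cyclic_code :: "nat \<Rightarrow> nat \<Rightarrow> bool list" where
  "cyclic_code M t = map (\<lambda>k. k < t \<and> t \<le> k + M) [0..<M]"

lemma length_cyclic_code [simp]: "length (cyclic_code M t) = M"
  by (simp add: cyclic_code_def)

text \<open>Each unit step from \<open>t\<close> flips only the bit \<open>t mod M\<close>. The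
  words therefore drift apart until every bit has flipped once; after that the differences cancel
  one by one.\<close>

lemma hamming_cyclic_code:
  assumes "s \<le> t" "t \<le> 2 * M"
  shows "min (t - s) (2 * M - (t - s)) \<le> hamming (cyclic_code M s) (cyclic_code M t)"
proof -
  let ?D = "{k. k < M \<and> (k < s \<and> s \<le> k + M) \<noteq> (k < t \<and> t \<le> k + M)}"
  have ham: "hamming (cyclic_code M s) (cyclic_code M t) = card ?D"
    unfolding hamming_def cyclic_code_def by (rule arg_cong[where f = card]) auto
  have card_ge: "card A \<le> card ?D" if "A \<subseteq> ?D" for A
    using that by (intro card_mono) auto
  \<comment> \<open>Up to \<open>M\<close> the ones form a prefix, from \<open>M\<close> on a
    suffix. In the two mixed cases the prefix below \<open>s\<close> and the suffix from
    \<open>t - M\<close> are disjoint or overlap, respectively.\<close>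
  consider "t \<le> M" | "M \<le> s" | "s < M" "M < t" "s \<le> t - M" | "s < M" "M < t" "t - M < s"
    by linarith
  then show ?thesis
  proof cases
    case 1
    with assms have "{s..<t} \<subseteq> ?D" by auto
    from card_ge[OF this] show ?thesis by (simp add: ham)
  next
    case 2
    with assms have "{s - M..<t - M} \<subseteq> ?D" by auto
    from card_ge[OF this] 2 show ?thesis by (simp add: ham)
  next
    case 3
    with assms have "{..<s} \<union> {t - M..<M} \<subseteq> ?D" by auto
    moreover have "card ({..<s} \<union> {t - M..<M}) = s + (M - (t - M))"
      using 3 by (subst card_Un_disjoint) auto
    ultimately show ?thesis using card_ge[of "{..<s} \<union> {t - M..<M}"] 3 assms by (simp add: ham)
  next
    case 4
    with assms have "{..<t - M} \<union> {s..<M} \<subseteq> ?D" by auto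
    moreover have "card ({..<t - M} \<union> {s..<M}) = (t - M) + (M - s)"
      using 4 by (subst card_Un_disjoint) auto
    ultimately show ?thesis using card_ge[of "{..<t - M} \<union> {s..<M}"] 4 assms by (simp add: ham)
  qed
qed

section \<open>Weighted distance\<close>

lemma wdist_le: "is_path G u p v \<Longrightarrow> wdist G u v \<le> enat (path_weight G p)"
  unfolding wdist_def by (auto intro: INF_lower)

lemma le_enat_min: "x \<le> enat a \<Longrightarrow> x \<le> enat b \<Longrightarrow> x \<le> enat (min a b)"
  by (simp add: min_def)

lemma Inf_enat_in:
  fixes A :: "enat set"
  assumes "A \<noteq> {}"
  shows "Inf A \<in> A"
  using assms LeastI_ex[of "\<lambda>x. x \<in> A"] by (auto simp: Inf_enat_def)

text \<open>A nonempty set in \<open>enat\<close> contains its infimum, so a shortest path exists as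
  soon as there is any path.\<close>

lemma wdist_cases:
  obtains (infinite) "wdist G u v = \<infinity>"
  | (path) p where "is_path G u p v" "wdist G u v = enat (path_weight G p)"
proof (cases "{p. is_path G u p v} = {}")
  case True
  then have "wdist G u v = \<infinity>"
    unfolding wdist_def by (simp add: top_enat_def)
  then show ?thesis by (rule infinite)
next
  case False
  then have "wdist G u v \<in> (\<lambda>p. enat (path_weight G p)) ` {p. is_path G u p v}"
    unfolding wdist_def by (intro Inf_enat_in) simp
  then show ?thesis
    by (auto intro: path)
qed

lemma potential_le_path_weight:
  fixes \<phi> :: "'a \<Rightarrow> int"
  assumes "\<And>a b. adj G a b \<Longrightarrow> \<phi> b \<le> \<phi> a + int (weight G a b)"
    and "p \<noteq> []" "successively (adj G) p"
  shows "\<phi> (last p) \<le> \<phi> (hd p) + int (path_weight G p)"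
  using assms(2,3)
proof (induction p rule: induct_list012)
  case (3 x y p)
  then show ?case using assms(1)[of x y] by auto
qed auto

text \<open>The dual certificate for shortest paths: a potential that no edge raises by more than
  its weight bounds all paths at once. Integer values keep differences free of truncation.\<close>

lemma potential_le_wdist:
  fixes \<phi> :: "'a \<Rightarrow> int"
  assumes "\<And>a b. adj G a b \<Longrightarrow> \<phi> b \<le> \<phi> a + int (weight G a b)"
    and "int k \<le> \<phi> v - \<phi> u"
  shows "enat k \<le> wdist G u v"
  unfolding wdist_def
proof (rule INF_greatest)
  fix p assume "p \<in> {p. is_path G u p v}"
  then show "enat k \<le> enat (path_weight G p)"
    using potential_le_path_weight[of G \<phi> p] assms by (force simp: is_path_def)
qed

lemma path_weight_append:
  "p \<noteq> [] \<Longrightarrow> q \<noteq> [] \<Longrightarrow>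
    path_weight G (p @ q) = path_weight G p + weight G (last p) (hd q) + path_weight G q"
proof (induction G p rule: path_weight.induct)
  case ("2_2" G x)
  then show ?case by (cases q) auto
qed auto

lemma wdist_commute_le:
  assumes "weighted_graph G"
  shows "wdist G v u \<le> wdist G u v"
proof (cases rule: wdist_cases[of G u v])
  case (path p)
  have sym: "adj G a b \<Longrightarrow> adj G b a" "adj G a b \<Longrightarrow> weight G a b = weight G b a" for a b
    using assms by (auto simp: weighted_graph_def)
  \<comment> \<open>Weights are symmetric on adjacent pairs only, so the list has to follow
    edges.\<close>
  have "path_weight G (rev q) = path_weight G q" if "successively (adj G) q" for q
    using that
  proof (induction q rule: induct_list012)
    case (3 x y q)
    then show ?case
      using path_weight_append[of "rev (y # q)" "[x]" G] sym(2)[of x y] by simp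
  qed auto
  moreover have "is_path G v (rev p) u"
    using path(1) by (auto simp: is_path_def hd_rev last_rev successively_rev
        intro: successively_mono sym(1))
  ultimately show ?thesis
    using path wdist_le by (metis is_path_def)
qed simp

lemma wdist_commute: "weighted_graph G \<Longrightarrow> wdist G u v = wdist G v u"
  by (simp add: wdist_commute_le order_antisym)

lemma weight_pos: "weighted_graph G \<Longrightarrow> adj G u v \<Longrightarrow> 0 < weight G u v"
  by (simp add: weighted_graph_def)

lemma weight_commute: "weighted_graph G \<Longrightarrow> adj G u v \<Longrightarrow> weight G u v = weight G v u"
  by (simp add: weighted_graph_def)

lemma wdist_adj: "weighted_graph G \<Longrightarrow> adj G u v \<Longrightarrow> wdist G u v = enat (weight G u v)"
  by (simp add: weighted_graph_def)

section \<open>Addressings\<close>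

text \<open>A shortest path in \<open>G\<close> at level \<open>x\<close> is followed by a shortest
  path of \<open>H\<close> in the fibre over \<open>v\<close>.\<close>

lemma wdist_cart_prod_le:
  assumes "weighted_graph H"
  shows "wdist (G \<box> H) (u, x) (v, y) \<le> wdist G u v + wdist H x y"
proof (cases rule: wdist_cases[of G u v])
  case p: (path p)
  show ?thesis
  proof (cases rule: wdist_cases[of H x y])
    case q: (path q)
    \<comment> \<open>The product picks the weight by comparing second coordinates; irreflexivity
      makes fibre edges use the weight of \<open>H\<close>.\<close>
    have irrefl: "\<not> adj H a a" for a
      using assms by (auto simp: weighted_graph_def)
    have x: "x \<in> verts H" and v: "v \<in> verts G"
      using p(1) q(1) by (auto simp: is_path_def)
    \<comment> \<open>Dropping the head of \<open>q\<close> keeps \<open>(v, x)\<close> from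
      occurring twice in the joined path.\<close>
    obtain q' where q': "q = x # q'"
      using q(1) by (cases q) (auto simp: is_path_def)
    have weight_p: "path_weight (G \<box> H) (map (\<lambda>a. (a, x)) r) = path_weight G r" for r
      by (induction G r rule: path_weight.induct) (auto simp: cart_prod_def)
    have weight_q: "path_weight (G \<box> H) (map (Pair v) r) = path_weight H r"
      if "successively (adj H) r" for r
      using that irrefl by (induction H r rule: path_weight.induct) (auto simp: cart_prod_def)
    have weight_edge: "weight (G \<box> H) (v, x) (v, b) = weight H x b" if "x \<noteq> b" for b
      using that by (simp add: cart_prod_def)
    let ?r = "map (\<lambda>a. (a, x)) p @ map (Pair v) q'"
    have p_path: "p \<noteq> []" "last p = v" "hd p = u" "set p \<subseteq> verts G" "distinct p"
        "successively (adj G) p"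
      using p(1) by (auto simp: is_path_def)
    have q_path: "x \<notin> set q'" "distinct q'" "set q' \<subseteq> verts H" "successively (adj H) (x # q')"
        "last (x # q') = y"
      using q(1) by (auto simp: is_path_def q')
    have "successively (adj (G \<box> H)) ?r"
      using p_path q_path x v
      by (auto simp: successively_append_iff successively_map cart_prod_def hd_map last_map
          successively_Cons elim!: successively_mono)
    then have "is_path (G \<box> H) (u, x) ?r (v, y)"
      using p_path q_path x v
      by (auto simp: is_path_def hd_append hd_map last_map distinct_map inj_on_def cart_prod_def
          split: if_splits)
    moreover have "path_weight (G \<box> H) ?r = path_weight G p + path_weight H q"
    proof (cases q')
      case Nil
      then show ?thesis by (simp add: q' weight_p)
    next
      case (Cons b q'')
      then show ?thesis
        using p_path q_path weight_q[of q']
        by (auto simp: q' path_weight_append weight_p last_map weight_edge)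
    qed
    ultimately show ?thesis
      using wdist_le p(2) q(2) by (metis plus_enat_simps(1))
  qed simp
qed simp

lemma is_addressing_cart_prod:
  assumes "weighted_graph H" "is_addressing G k f" "is_addressing H l g"
  shows "is_addressing (G \<box> H) (k + l) (\<lambda>(u, x). f u @ g x)"
  unfolding is_addressing_def
proof (intro conjI ballI)
  fix a b assume "a \<in> verts (G \<box> H)" "b \<in> verts (G \<box> H)"
  then obtain u x v y where *: "a = (u, x)" "b = (v, y)"
      "u \<in> verts G" "v \<in> verts G" "x \<in> verts H" "y \<in> verts H"
    by (auto simp: cart_prod_def)
  have "wdist (G \<box> H) a b \<le> wdist G u v + wdist H x y"
    using wdist_cart_prod_le[OF assms(1)] * by simp
  also have "\<dots> \<le> enat (hamming (f u) (f v)) + enat (hamming (g x) (g y))"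
    using assms(2,3) * by (intro add_mono) (auto simp: is_addressing_def)
  finally show "wdist (G \<box> H) a b
      \<le> enat (hamming (case a of (u, x) \<Rightarrow> f u @ g x) (case b of (u, x) \<Rightarrow> f u @ g x))"
    using assms(2,3) * by (simp add: hamming_append is_addressing_def)
qed (use assms in \<open>auto simp: is_addressing_def cart_prod_def\<close>)

lemma addressing_number_le: "is_addressing G k f \<Longrightarrow> addressing_number G \<le> k"
  unfolding addressing_number_def by (intro Least_le) blast

lemma addressing_number_attained:
  assumes "is_addressing G k f"
  obtains g where "is_addressing G (addressing_number G) g"
proof -
  have "\<exists>g. is_addressing G (addressing_number G) g"
    unfolding addressing_number_def using assms by (intro LeastI[of "\<lambda>m. \<exists>g. is_addressing G m g"]) blast
  then show ?thesis using that by blast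
qed

lemma addressing_number_cart_prod_le:
  assumes "weighted_graph H" "is_addressing G k f" "is_addressing H l g"
  shows "addressing_number (G \<box> H) \<le> addressing_number G + addressing_number H"
  by (metis assms is_addressing_cart_prod addressing_number_le addressing_number_attained)

section \<open>Paths and cycles\<close>

text \<open>The coordinate of a vertex when the path, or the cycle cut open at its edge from
  \<open>n - 1\<close> to \<open>0\<close>, is laid out on a line.\<close>

definition position :: "(nat \<Rightarrow> nat \<Rightarrow> nat) \<Rightarrow> nat \<Rightarrow> nat" where
  "position w i = (\<Sum>k<i. w k (Suc k))"

lemma position_0 [simp]: "position w 0 = 0"
  by (simp add: position_def)

lemma position_Suc [simp]: "position w (Suc i) = position w i + w i (Suc i)"
  by (simp add: position_def)

lemma position_mono: "i \<le> j \<Longrightarrow> position w i \<le> position w j"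
  by (rule lift_Suc_mono_le) auto

lemma path_weight_upt:
  assumes "weight G = w"
  shows "i \<le> j \<Longrightarrow> path_weight G [i..<Suc j] = position w j - position w i"
proof (induction j)
  case (Suc j)
  show ?case
  proof (cases "i = Suc j")
    case False
    with Suc.prems have "i \<le> j" by simp
    then show ?thesis
      using Suc.IH assms path_weight_append[of "[i..<Suc j]" "[Suc j]" G] position_mono[of i j w]
      by (simp add: last_append)
  qed simp
qed simp

lemma successively_upt:
  assumes "\<And>k. i \<le> k \<Longrightarrow> Suc k < j \<Longrightarrow> R k (Suc k)"
  shows "successively R [i..<j]"
  using assms by (auto simp: successively_conv_nth)

lemma weight_path_graph [simp]: "weight (path_graph n w) = w"
  by (simp add: path_graph_def)

lemma weight_cycle_graph [simp]: "weight (cycle_graph n w) = w"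
  by (simp add: cycle_graph_def)

section \<open>Explicit addressings of paths and cycles\<close>

lemma wdist_path_graph_le:
  assumes "i \<le> j" "j < n"
  shows "wdist (path_graph n w) i j \<le> enat (position w j - position w i)"
proof -
  have "is_path (path_graph n w) i [i..<Suc j] j"
    using assms by (auto simp: is_path_def path_graph_def hd_append simp del: upt_Suc
        intro!: successively_upt)
  from wdist_le[OF this] show ?thesis
    using path_weight_upt[of "path_graph n w" w] assms by simp
qed

text \<open>All positions lie in the first half of the code cycle, where the minimum in
  \<open>hamming_cyclic_code\<close> is the difference of positions.\<close>

lemma is_addressing_path_graph:
  assumes "weighted_graph (path_graph n w)"
  shows "is_addressing (path_graph n w) (position w (n - 1))
    (\<lambda>i. cyclic_code (position w (n - 1)) (position w i))"
proof -
  have le: "wdist (path_graph n w) i j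
      \<le> enat (hamming (cyclic_code (position w (n - 1)) (position w i))
                    (cyclic_code (position w (n - 1)) (position w j)))"
    if "i \<le> j" "j < n" for i j
  proof -
    have "position w i \<le> position w j" "position w j \<le> position w (n - 1)"
      using that by (auto intro: position_mono)
    then have "position w j - position w i
        \<le> hamming (cyclic_code (position w (n - 1)) (position w i))
                    (cyclic_code (position w (n - 1)) (position w j))"
      using hamming_cyclic_code[of "position w i" "position w j" "position w (n - 1)"] by linarith
    then show ?thesis
      using wdist_path_graph_le[OF that, of w] by (meson enat_ord_simps(1) order_trans)
  qed
  have "wdist (path_graph n w) i j
      \<le> enat (hamming (cyclic_code (position w (n - 1)) (position w i))
                    (cyclic_code (position w (n - 1)) (position w j)))"
    if "i < n" "j < n" for i j
    using le[of i j] le[of j i] that wdist_commute[OF assms, of i j] hamming_commute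
    by (metis length_cyclic_code nat_le_linear)
  then show ?thesis
    by (auto simp: is_addressing_def path_graph_def)
qed

definition perimeter :: "nat \<Rightarrow> (nat \<Rightarrow> nat \<Rightarrow> nat) \<Rightarrow> nat" where
  "perimeter n w = position w (n - 1) + w (n - 1) 0"

lemma wdist_cycle_graph_le:
  assumes "i \<le> j" "j < n"
  shows "wdist (cycle_graph n w) i j \<le> enat (position w j - position w i)"
proof -
  have "is_path (cycle_graph n w) i [i..<Suc j] j"
    using assms by (auto simp: is_path_def cycle_graph_def hd_append simp del: upt_Suc
        intro!: successively_upt)
  from wdist_le[OF this] show ?thesis
    using path_weight_upt[of "cycle_graph n w" w] assms by simp
qed

text \<open>The other arc, through the closing edge; its vertices are distinct because
  \<open>i < j\<close>.\<close>

lemma wdist_cycle_graph_le_complement: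
  assumes "i < j" "j < n"
  shows "wdist (cycle_graph n w) j i \<le> enat (perimeter n w - (position w j - position w i))"
proof -
  let ?p = "[j..<Suc (n - 1)] @ [0..<Suc i]"
  have n: "Suc (n - 1) = n"
    using assms by simp
  have "is_path (cycle_graph n w) j ?p i"
    unfolding n using assms
    by (auto simp: is_path_def cycle_graph_def hd_append last_append successively_append_iff
        simp del: upt_Suc intro!: successively_upt)
  moreover have "path_weight (cycle_graph n w) ?p
      = position w (n - 1) - position w j + w (n - 1) 0 + position w i"
    using assms path_weight_append[of "[j..<Suc (n - 1)]" "[0..<Suc i]" "cycle_graph n w"]
      path_weight_upt[of "cycle_graph n w" w j "n - 1"] path_weight_upt[of "cycle_graph n w" w 0 i]
    by (simp del: upt_Suc)
  moreover have "position w i \<le> position w j" "position w j \<le> position w (n - 1)"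
    using assms by (auto intro: position_mono)
  ultimately show ?thesis
    using wdist_le[of "cycle_graph n w" j ?p i] by (simp add: perimeter_def)
qed

lemma is_addressing_cycle_graph:
  fixes n w
  defines "M \<equiv> (perimeter n w + 1) div 2"
  assumes "weighted_graph (cycle_graph n w)"
  shows "is_addressing (cycle_graph n w) M (\<lambda>i. cyclic_code M (position w i))"
proof -
  have le: "wdist (cycle_graph n w) i j
      \<le> enat (hamming (cyclic_code M (position w i)) (cyclic_code M (position w j)))"
    if "i \<le> j" "j < n" for i j
  proof -
    let ?d = "position w j - position w i"
    have mono: "position w i \<le> position w j" "position w j \<le> position w (n - 1)"
      using that by (auto intro: position_mono)
    have M: "perimeter n w \<le> 2 * M"
      by (simp add: M_def)
    have "wdist (cycle_graph n w) i j \<le> enat (min ?d (perimeter n w - ?d))"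
    proof (cases "i = j")
      case True
      then show ?thesis
        using wdist_cycle_graph_le[OF that, of w] by simp
    next
      case False
      then show ?thesis
        using that wdist_cycle_graph_le[OF that, of w] wdist_cycle_graph_le_complement[of i j n w]
          wdist_commute[OF assms(2), of i j] by (intro le_enat_min) simp_all
    qed
    \<comment> \<open>Rounding an odd perimeter up to \<open>2 * M\<close> only lengthens the
      complementary arc.\<close>
    also have "\<dots> \<le> enat (min ?d (2 * M - ?d))"
      unfolding enat_ord_simps using M by (intro min.mono diff_le_mono order_refl)
    also have "\<dots> \<le> enat (hamming (cyclic_code M (position w i)) (cyclic_code M (position w j)))"
    proof -
      have "position w j \<le> 2 * M"
        using mono M unfolding perimeter_def by linarith
      then show ?thesis
        using hamming_cyclic_code[of "position w i" "position w j" M] mono by simp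
    qed
    finally show ?thesis .
  qed
  have "wdist (cycle_graph n w) i j
      \<le> enat (hamming (cyclic_code M (position w i)) (cyclic_code M (position w j)))"
    if "i < n" "j < n" for i j
    using le[of i j] le[of j i] that wdist_commute[OF assms(2), of i j] hamming_commute
    by (metis length_cyclic_code nat_le_linear)
  then show ?thesis
    by (auto simp: is_addressing_def cycle_graph_def)
qed

section \<open>Lower bound for the product of a cycle and a path\<close>

definition arc_dist :: "nat \<Rightarrow> (nat \<Rightarrow> nat \<Rightarrow> nat) \<Rightarrow> nat \<Rightarrow> nat \<Rightarrow> int" where
  "arc_dist n w i j = (let d = \<bar>int (position w i) - int (position w j)\<bar>
    in min d (int (perimeter n w) - d))"

text \<open>Crossing an edge lengthens one of the two arcs from \<open>i\<close> by its weight and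
  shortens the other equally. For the closing edge this holds because
  \<open>position w (n - 1)\<close> is the perimeter minus its weight.\<close>

lemma arc_dist_adj:
  assumes "weighted_graph (cycle_graph n w)" "i < n" "adj (cycle_graph n w) a b"
  shows "arc_dist n w i b \<le> arc_dist n w i a + int (w a b)"
proof -
  have sym: "w a b = w b a"
    using weight_commute[OF assms(1,3)] by simp
  have i: "position w i \<le> position w (n - 1)"
    using assms(2) by (intro position_mono) simp
  have next_eq: "Suc k mod n = (if k = n - 1 then 0 else Suc k)" if "k < n" for k
    using that by (cases "Suc k = n") auto
  have "a < n" "b < n" "b = Suc a mod n \<or> a = Suc b mod n"
    using assms(3) by (simp_all add: cycle_graph_def)
  then consider "b = Suc a" | "a = Suc b" | "a = n - 1" "b = 0" | "a = 0" "b = n - 1"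
    using next_eq[of a] next_eq[of b] by metis
  then show ?thesis
  proof cases
    case 1
    then show ?thesis
      unfolding arc_dist_def Let_def by simp
  next
    case 2
    then show ?thesis
      using sym unfolding arc_dist_def Let_def by simp
  next
    case 3
    then show ?thesis
      using i unfolding arc_dist_def Let_def perimeter_def by simp linarith
  next
    case 4
    then show ?thesis
      using i sym unfolding arc_dist_def Let_def perimeter_def by simp linarith
  qed
qed

text \<open>The potential adds the shorter arc from \<open>u\<close> to the distance of positions
  from \<open>x\<close>. It vanishes at \<open>(u, x)\<close>, and a product edge changes only one
  summand.\<close>

lemma wdist_cycle_path_ge:
  assumes "weighted_graph (cycle_graph n w)" "weighted_graph (path_graph m w')" "u < n"
    and "int k \<le> arc_dist n w u v + \<bar>int (position w' x) - int (position w' y)\<bar>"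
  shows "enat k \<le> wdist (cycle_graph n w \<box> path_graph m w') (u, x) (v, y)"
proof (rule potential_le_wdist)
  let ?\<phi> = "\<lambda>(v, y). arc_dist n w u v + \<bar>int (position w' x) - int (position w' y)\<bar>"
  show "int k \<le> ?\<phi> (v, y) - ?\<phi> (u, x)"
    using assms(4) by (auto simp: arc_dist_def Let_def)
  fix a b assume adj: "adj (cycle_graph n w \<box> path_graph m w') a b"
  obtain a1 a2 b1 b2 where ab: "a = (a1, a2)" "b = (b1, b2)"
    by (cases a, cases b)
  from adj consider "adj (cycle_graph n w) a1 b1" "a2 = b2"
    | "a1 = b1" "adj (path_graph m w') a2 b2"
    by (auto simp: ab cart_prod_def)
  then show "?\<phi> b \<le> ?\<phi> a + int (weight (cycle_graph n w \<box> path_graph m w') a b)"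
  proof cases
    case 1
    then show ?thesis
      using arc_dist_adj[OF assms(1,3)] by (simp add: ab cart_prod_def cycle_graph_def)
  next
    case 2
    have "w' a2 b2 = w' b2 a2"
      using weight_commute[OF assms(2) 2(2)] by simp
    with 2 show ?thesis
      by (auto simp: ab cart_prod_def path_graph_def)
  qed
qed

text \<open>The vertex \<open>0\<close> and the end points of this edge form the triangle of perimeter \<open>W\<close>.\<close>

lemma halving_edge:
  assumes "n \<ge> 3" "weighted_graph (cycle_graph n w)"
  obtains y where "Suc y < n" "2 * position w y < perimeter n w"
    "perimeter n w \<le> 2 * position w (Suc y)" "2 * w y (Suc y) \<le> perimeter n w"
proof -
  let ?C = "cycle_graph n w" and ?W = "perimeter n w"
  have adj0: "adj ?C (n - 1) 0"
    using assms(1) by (simp add: cycle_graph_def)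
  then have "0 < w (n - 1) 0"
    using weight_pos[OF assms(2)] by simp
  then have pos: "0 < ?W"
    by (simp add: perimeter_def)
  \<comment> \<open>Minimality of the closing edge against the rest of the cycle shows that vertex
    \<open>n - 1\<close> lies at or beyond the halfway point.\<close>
  have "enat (w (n - 1) 0) = wdist ?C 0 (n - 1)"
    using wdist_adj[OF assms(2) adj0] wdist_commute[OF assms(2), of "n - 1" 0]
    by (simp add: cycle_graph_def)
  also have "\<dots> \<le> enat (position w (n - 1))"
    using wdist_cycle_graph_le[of 0 "n - 1" n w] assms(1) by simp
  finally have half: "?W \<le> 2 * position w (n - 1)"
    by (simp add: perimeter_def)
  \<comment> \<open>The first vertex at or beyond the halfway point; it is not \<open>0\<close>
    since the perimeter is positive.\<close>
  define z where "z = (LEAST z. ?W \<le> 2 * position w z)"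
  have z: "?W \<le> 2 * position w z" "z \<le> n - 1"
    unfolding z_def using half by (fact LeastI, fact Least_le)
  with pos obtain y where y: "z = Suc y"
    by (cases z) auto
  have "\<not> ?W \<le> 2 * position w y"
    using not_less_Least[of y "\<lambda>z. ?W \<le> 2 * position w z"] y by (simp add: z_def)
  moreover have yn: "Suc y < n"
    using z y assms(1) by simp
  \<comment> \<open>Minimality of the edge from \<open>y\<close> to \<open>Suc y\<close> against its
    complementary arc.\<close>
  moreover have "2 * w y (Suc y) \<le> ?W"
  proof -
    have "enat (w y (Suc y)) = wdist ?C y (Suc y)"
      using wdist_adj[OF assms(2), of y "Suc y"] yn by (simp add: cycle_graph_def)
    also have "\<dots> \<le> enat (?W - w y (Suc y))"
      using wdist_cycle_graph_le_complement[of y "Suc y" n w] yn wdist_commute[OF assms(2)] by simp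
    finally have "w y (Suc y) \<le> ?W - w y (Suc y)" by simp
    moreover have "position w (Suc y) \<le> ?W"
      using position_mono[of "Suc y" "n - 1" w] yn unfolding perimeter_def by linarith
    ultimately show ?thesis by simp
  qed
  ultimately show ?thesis
    using that z y by simp
qed

lemma is_addressing_cycle_path_length_ge:
  assumes "n \<ge> 3" "m \<ge> 1" "weighted_graph (cycle_graph n w)" "weighted_graph (path_graph m w')"
    and "is_addressing (cycle_graph n w \<box> path_graph m w') N f"
  shows "perimeter n w + 2 * position w' (m - 1) \<le> 2 * N"
proof -
  let ?W = "perimeter n w" and ?L = "position w' (m - 1)" and ?p = "position w"
  obtain y where y: "Suc y < n" "2 * ?p y < ?W" "?W \<le> 2 * ?p (Suc y)" "2 * w y (Suc y) \<le> ?W"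
    using halving_edge[OF assms(1,3)] .
  have z: "?p (Suc y) \<le> ?W"
    using position_mono[of "Suc y" "n - 1" w] y(1) unfolding perimeter_def by linarith
  let ?a = "(0, 0)" and ?b = "(y, m - 1)" and ?c = "(Suc y, 0)"
  let ?d = "wdist (cycle_graph n w \<box> path_graph m w')"
  \<comment> \<open>By the choice of \<open>y\<close> each of these three arcs is at most half the
    perimeter, so it is the shorter one. The arcs add up to the perimeter, and the two sides at
    \<open>?b\<close> each contribute \<open>?L\<close>.\<close>
  have ge: "enat (?p y + ?L) \<le> ?d ?a ?b" "enat (w y (Suc y) + ?L) \<le> ?d ?b ?c"
      "enat (?W - ?p (Suc y)) \<le> ?d ?a ?c"
    by (rule wdist_cycle_path_ge[OF assms(3,4)]; use y z in \<open>auto simp: arc_dist_def Let_def\<close>)+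
  have verts: "?a \<in> verts (cycle_graph n w \<box> path_graph m w')"
      "?b \<in> verts (cycle_graph n w \<box> path_graph m w')"
      "?c \<in> verts (cycle_graph n w \<box> path_graph m w')"
    using y assms(2) by (auto simp: cart_prod_def cycle_graph_def path_graph_def)
  have ham: "k \<le> hamming (f u) (f v)"
    if "enat k \<le> ?d u v" "u \<in> verts (cycle_graph n w \<box> path_graph m w')"
      "v \<in> verts (cycle_graph n w \<box> path_graph m w')" for k u v
    using assms(5) that unfolding is_addressing_def by (meson enat_ord_simps(1) order_trans)
  have "hamming (f ?a) (f ?b) + hamming (f ?b) (f ?c) + hamming (f ?a) (f ?c) \<le> 2 * N"
    using assms(5) verts by (intro hamming_perimeter_le) (auto simp: is_addressing_def)
  then show ?thesis
    using ham[OF ge(1) verts(1,2)] ham[OF ge(2) verts(2,3)] ham[OF ge(3) verts(1,3)] z by simp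
qed

theorem theorem7:
  fixes n m :: nat and w w' :: "nat \<Rightarrow> nat \<Rightarrow> nat"
  assumes "n \<ge> 3" and "m \<ge> 1"
    and "weighted_graph (cycle_graph n w)"
    and "weighted_graph (path_graph m w')"
  shows "addressing_number (cycle_graph n w \<box> path_graph m w') =
         addressing_number (cycle_graph n w) + addressing_number (path_graph m w')"
proof (rule antisym)
  let ?C = "cycle_graph n w" and ?P = "path_graph m w'"
  let ?M = "(perimeter n w + 1) div 2" and ?L = "position w' (m - 1)"
  note C = is_addressing_cycle_graph[OF assms(3)] and P = is_addressing_path_graph[OF assms(4)]
  show "addressing_number (?C \<box> ?P) \<le> addressing_number ?C + addressing_number ?P"
    using addressing_number_cart_prod_le[OF assms(4) C P] .
  obtain f where "is_addressing (?C \<box> ?P) (addressing_number (?C \<box> ?P)) f"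
    using addressing_number_attained[OF is_addressing_cart_prod[OF assms(4) C P]] .
  then have "perimeter n w + 2 * ?L \<le> 2 * addressing_number (?C \<box> ?P)"
    by (rule is_addressing_cycle_path_length_ge[OF assms])
  \<comment> \<open>The address length is an integer, so halving the inequality allows rounding up:
    \<open>?M + ?L\<close> bounds it from below, while the codes bound the sum for the factors by
    \<open>?M + ?L\<close> from above.\<close>
  then show "addressing_number ?C + addressing_number ?P \<le> addressing_number (?C \<box> ?P)"
    using addressing_number_le[OF C] addressing_number_le[OF P] by linarith
qed

end
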